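(* The decomposition error of the reconstructed density equals the Frobenius-norm error of the approximated coefficient tensor: $$\varepsilon_{\mathrm{CTT}}:=\left\|\hat f-\hat f_{\mathbf{r}\text{-}\mathrm{CTT}}\right\|_{L^2(\mathbf{D})}=\left\|\mathcal{A}-\hat{\mathcal{A}}\right\|_F.$$
   Context: Let $d\ge1$ and $\mathbf{D}=D_1\times\cdots\times D_d\subset\mathbb{R}^d$ with $D_j=[l_j,u_j]$, $l_j<u_j$. Let $f$ be a continuous probability density on $\mathbb{R}^d$ with restriction to $\mathbf{D}$ in $L^2(\mathbf{D})$, and let $\varphi(\boldsymbol{\omega})=\int_{\mathbb{R}^d}f(\mathbf{x})e^{i\boldsymbol{\omega}\cdot\mathbf{x}}\,d\mathbf{x}$ be its characteristic function. Let $K_1,\ldots,K_d\ge1$ be integers; sums over $\mathbf{k}$ run over all multi-indices $\mathbf{k}=(k_1,\ldots,k_d)$ with $0\le k_j\le K_j-1$. The normalized product cosine basis is $$\Phi_{\mathbf{k}}(\mathbf{x})=\prod_{j=1}^d\phi^{(j)}_{k_j}(x_j),\qquad \phi^{(j)}_{k}(x)=\beta^{(j)}_{k}\cos\!\left(\frac{k\pi}{u_j-l_j}(x-l_j)\right),$$ with $\beta^{(j)}_0=\sqrt{1/(u_j-l_j)}$ and $\beta^{(j)}_k=\sqrt{2/(u_j-l_j)}$ for $k\ge1$. The COS coefficient tensor $\mathcal{A}\in\mathbb{R}^{K_1\times\cdots\times K_d}$ has entries $$\mathcal{A}_{\mathbf{k}}=\frac{\prod_{j=1}^d\beta^{(j)}_{k_j}}{2^{d-1}}\sum_{\mathbf{s}\in\mathcal{S}_d}\operatorname{Re}\left\{\exp\!\left(-i\sum_{j=1}^d\frac{s_jk_j\pi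 l_j}{u_j-l_j}\right)\varphi\!\left(\frac{s_1k_1\pi}{u_1-l_1},\ldots,\frac{s_dk_d\pi}{u_d-l_d}\right)\right\},$$ where $\mathcal{S}_d=\{(1,s_2,\ldots,s_d):s_i\in\{-1,+1\}\}$. The COS density approximation is $\hat f(\mathbf{x})=\sum_{\mathbf{k}}\mathcal{A}_{\mathbf{k}}\Phi_{\mathbf{k}}(\mathbf{x})$ for $\mathbf{x}\in\mathbf{D}$. Let $\mathbf{r}=(r_1,\ldots,r_{d-1})$ be positive integers (tensor-train ranks), $r_0=r_d=1$, and let $\hat A_j\in\mathbb{R}^{r_{j-1}\times K_j\times r_j}$, $j=1,\ldots,d$, be given cores. The rank-$\mathbf{r}$ tensor-train reconstruction approximating $\mathcal{A}$ is $$\hat{\mathcal{A}}_{\mathbf{k}}=\sum_{\alpha_1=1}^{r_1}\cdots\sum_{\alpha_{d-1}=1}^{r_{d-1}}\prod_{j=1}^d\hat A_j(\alpha_{j-1},k_j,\alpha_j),\qquad \alpha_0=\alpha_d=1,$$ and the corresponding COS-TT density is $$\hat f_{\mathbf{r}\text{-}\mathrm{CTT}}(\mathbf{x})=\sum_{\alpha_1=1}^{r_1}\cdots\sum_{\alpha_{d-1}=1}^{r_{d-1}}\prod_{j=1}^d\left(\sum_{k_j=0}^{K_j-1}\hat A_j(\alpha_{j-1},k_j,\alpha_j)\,\phi^{(j)}_{k_j}(x_j)\right),\qquad \mathbf{x}\in\mathbf{D}.$$ $\|\cdot\|_F$ is the Frobenius norm, $\|\mathcal{T}\|_F^2=\sum_{\mathbf{k}}|\mathcal{T}_{\mathbf{k}}|^2$.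 *)

theory Defs
  imports "HOL-Analysis.Analysis"
begin

text \<open>
  The space \<open>\<real>\<^sup>d\<close> is modelled by the extensional functions on \<open>{1..d}\<close>, the space of the
  product measure below; the topology used on them is the one inherited from the product topology
  on \<^typ>\<open>nat \<Rightarrow> real\<close>. An explicit ordered index set is needed because neighbouring tensor-train
  cores share a rank index.
\<close>

definition Rn :: "nat \<Rightarrow> (nat \<Rightarrow> real) set" where
  "Rn d = PiE {1..d} (\<lambda>_. UNIV)"

definition lborel_Rn :: "nat \<Rightarrow> (nat \<Rightarrow> real) measure" where
  "lborel_Rn d = PiM {1..d} (\<lambda>_. lborel)"

definition box_Rn :: "nat \<Rightarrow> (nat \<Rightarrow> real) \<Rightarrow> (nat \<Rightarrow> real) \<Rightarrow> (nat \<Rightarrow> real) set" where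
  "box_Rn d l u = PiE {1..d} (\<lambda>j. {l j..u j})"

definition in_L2 :: "'a measure \<Rightarrow> 'a set \<Rightarrow> ('a \<Rightarrow> real) \<Rightarrow> bool" where
  "in_L2 M D g \<longleftrightarrow> set_borel_measurable M D g \<and> set_integrable M D (\<lambda>x. \<bar>g x\<bar>\<^sup>2)"

text \<open>The value is meaningful only for functions satisfying \<^const>\<open>in_L2\<close>.\<close>

definition L2_norm :: "'a measure \<Rightarrow> 'a set \<Rightarrow> ('a \<Rightarrow> real) \<Rightarrow> real" where
  "L2_norm M D g = sqrt (LINT x:D|M. \<bar>g x\<bar>\<^sup>2)"

definition char_fun :: "nat \<Rightarrow> ((nat \<Rightarrow> real) \<Rightarrow> real) \<Rightarrow> (nat \<Rightarrow> real) \<Rightarrow> complex" where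
  "char_fun d f \<omega> =
     (LINT x|lborel_Rn d. complex_of_real (f x) * exp (\<i> * complex_of_real (\<Sum>j=1..d. \<omega> j * x j)))"

definition beta :: "(nat \<Rightarrow> real) \<Rightarrow> (nat \<Rightarrow> real) \<Rightarrow> nat \<Rightarrow> nat \<Rightarrow> real" where
  "beta l u j k = (if k = 0 then sqrt (1 / (u j - l j)) else sqrt (2 / (u j - l j)))"

definition phi :: "(nat \<Rightarrow> real) \<Rightarrow> (nat \<Rightarrow> real) \<Rightarrow> nat \<Rightarrow> nat \<Rightarrow> real \<Rightarrow> real" where
  "phi l u j k x = beta l u j k * cos (real k * pi / (u j - l j) * (x - l j))"

definition Phi :: "nat \<Rightarrow> (nat \<Rightarrow> real) \<Rightarrow> (nat \<Rightarrow> real) \<Rightarrow> (nat \<Rightarrow> nat) \<Rightarrow> (nat \<Rightarrow> real) \<Rightarrow> real" where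
  "Phi d l u k x = (\<Prod>j=1..d. phi l u j (k j) (x j))"

definition multi_indices :: "nat \<Rightarrow> (nat \<Rightarrow> nat) \<Rightarrow> (nat \<Rightarrow> nat) set" where
  "multi_indices d K = PiE {1..d} (\<lambda>j. {0..<K j})"

definition sign_vectors :: "nat \<Rightarrow> (nat \<Rightarrow> real) set" where
  "sign_vectors d = PiE {1..d} (\<lambda>j. if j = 1 then {1} else {-1, 1})"

definition COS_tensor ::
  "nat \<Rightarrow> (nat \<Rightarrow> real) \<Rightarrow> (nat \<Rightarrow> real) \<Rightarrow> ((nat \<Rightarrow> real) \<Rightarrow> real) \<Rightarrow> (nat \<Rightarrow> nat) \<Rightarrow> real" where
  "COS_tensor d l u f k =
     (\<Prod>j=1..d. beta l u j (k j)) / 2 ^ (d - 1) *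
     (\<Sum>s\<in>sign_vectors d.
        Re (exp (- \<i> * complex_of_real (\<Sum>j=1..d. s j * real (k j) * pi * l j / (u j - l j))) *
            char_fun d f (\<lambda>j. s j * real (k j) * pi / (u j - l j))))"

definition COS_density ::
  "nat \<Rightarrow> (nat \<Rightarrow> nat) \<Rightarrow> (nat \<Rightarrow> real) \<Rightarrow> (nat \<Rightarrow> real) \<Rightarrow> ((nat \<Rightarrow> real) \<Rightarrow> real) \<Rightarrow> (nat \<Rightarrow> real) \<Rightarrow> real" where
  "COS_density d K l u f x = (\<Sum>k\<in>multi_indices d K. COS_tensor d l u f k * Phi d l u k x)"

text \<open>
  Rank indices are the tuples \<open>(\<alpha>\<^sub>0, \<dots>, \<alpha>\<^sub>d)\<close> with \<open>\<alpha>\<^sub>0 = \<alpha>\<^sub>d = 1\<close>.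
  An entry \<open>A\<^sub>j(a, k, b)\<close> of the \<open>j\<close>-th core is written \<open>A j a k b\<close>, with
  \<open>a\<close> and \<open>b\<close> counted from 1 and \<open>k\<close> from 0.
\<close>

definition rank_indices :: "nat \<Rightarrow> (nat \<Rightarrow> nat) \<Rightarrow> (nat \<Rightarrow> nat) set" where
  "rank_indices d r = PiE {0..d} (\<lambda>j. if j = 0 \<or> j = d then {1} else {1..r j})"

definition TT_tensor ::
  "nat \<Rightarrow> (nat \<Rightarrow> nat) \<Rightarrow> (nat \<Rightarrow> nat \<Rightarrow> nat \<Rightarrow> nat \<Rightarrow> real) \<Rightarrow> (nat \<Rightarrow> nat) \<Rightarrow> real" where
  "TT_tensor d r A k = (\<Sum>\<alpha>\<in>rank_indices d r. \<Prod>j=1..d. A j (\<alpha> (j - 1)) (k j) (\<alpha> j))"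

definition COS_TT_density ::
  "nat \<Rightarrow> (nat \<Rightarrow> nat) \<Rightarrow> (nat \<Rightarrow> real) \<Rightarrow> (nat \<Rightarrow> real) \<Rightarrow> (nat \<Rightarrow> nat) \<Rightarrow>
   (nat \<Rightarrow> nat \<Rightarrow> nat \<Rightarrow> nat \<Rightarrow> real) \<Rightarrow> (nat \<Rightarrow> real) \<Rightarrow> real" where
  "COS_TT_density d K l u r A x =
     (\<Sum>\<alpha>\<in>rank_indices d r. \<Prod>j=1..d.
        (\<Sum>k=0..<K j. A j (\<alpha> (j - 1)) k (\<alpha> j) * phi l u j k (x j)))"

definition frobenius_norm :: "nat \<Rightarrow> (nat \<Rightarrow> nat) \<Rightarrow> ((nat \<Rightarrow> nat) \<Rightarrow> real) \<Rightarrow> real" where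
  "frobenius_norm d K T = sqrt (\<Sum>k\<in>multi_indices d K. \<bar>T k\<bar>\<^sup>2)"

end

theory Submission
  imports Defs
begin

text \<open>
  By distributivity the COS-TT density is the expansion of the reconstructed tensor in the basis
  \<open>\<Phi>\<^sub>k\<close>. The products \<open>\<Phi>\<^sub>k\<close> are orthonormal on the box by Fubini and the orthonormality of
  the cosines on each interval, so the claim is Parseval's identity for a finite expansion.
\<close>

text \<open>The antiderivative \<open>sin (c * (x - a)) / c\<close> vanishes at both endpoints,
  because the interval length is a whole number of half periods. The frequency \<open>n\<close> is
  an integer, not a natural number, since differences \<open>k - m\<close> of either sign are
  plugged in later.\<close>

lemma has_bochner_integral_cos_multiple:
  fixes a b :: real and n :: int
  assumes "a < b"
  shows "has_bochner_integral lborel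
    (\<lambda>x. cos (of_int n * pi / (b - a) * (x - a)) * indicator {a..b} x) (if n = 0 then b - a else 0)"
proof (cases "n = 0")
  case True
  have "has_bochner_integral lborel (\<lambda>x. 1 * indicator {a..b} x) (b - a)"
    by (rule has_bochner_integral_FTC_Icc_real) (use assms in \<open>auto intro!: derivative_eq_intros\<close>)
  with True show ?thesis by simp
next
  case False
  define c where "c = of_int n * pi / (b - a)"
  have "c \<noteq> 0" using False assms by (simp add: c_def)
  have "c * (b - a) = of_int n * pi" using assms by (simp add: c_def)
  moreover have "sin (of_int n * pi) = 0"
    by (metis mult.commute sin_npi_int)
  moreover have "has_bochner_integral lborel (\<lambda>x. cos (c * (x - a)) * indicator {a..b} x)
      (sin (c * (b - a)) / c - sin (c * (a - a)) / c)"
    by (rule has_bochner_integral_FTC_Icc_real)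
      (use assms \<open>c \<noteq> 0\<close> in \<open>auto intro!: derivative_eq_intros continuous_intros\<close>)
  ultimately show ?thesis using False by (simp add: c_def)
qed

text \<open>The product-to-sum formula turns two cosines into half the sum of the cosines with
  frequencies \<open>k - m\<close> and \<open>k + m\<close>, so only vanishing frequencies
  contribute.\<close>

lemma has_bochner_integral_phi_mult_phi:
  assumes "l j < u j"
  shows "has_bochner_integral lborel
    (\<lambda>x. phi l u j k x * phi l u j m x * indicator {l j..u j} x) (if k = m then 1 else 0)"
proof -
  define b where "b = beta l u j k * beta l u j m / 2"
  let ?C = "\<lambda>n x. cos (of_int n * pi / (u j - l j) * (x - l j)) * indicator {l j..u j} x"
  let ?J = "\<lambda>n::int. if n = 0 then u j - l j else 0"
  have "has_bochner_integral lborel (\<lambda>x. b * (?C (int k - int m) x + ?C (int k + int m) x))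
      (b * (?J (int k - int m) + ?J (int k + int m)))"
    by (intro has_bochner_integral_mult_right has_bochner_integral_add
        has_bochner_integral_cos_multiple assms)
  \<comment> \<open>For \<open>k \<noteq> m\<close> neither frequency is zero. For
    \<open>k = m > 0\<close> only the difference vanishes, for \<open>k = m = 0\<close> both do; the
    smaller constant \<open>beta l u j 0\<close> compensates for this doubling.\<close>
  moreover have "b * (?J (int k - int m) + ?J (int k + int m)) = (if k = m then 1 else 0)"
    using assms by (auto simp: b_def beta_def divide_simps simp flip: real_sqrt_mult)
  moreover have "b * (?C (int k - int m) x + ?C (int k + int m) x)
      = phi l u j k x * phi l u j m x * indicator {l j..u j} x" for x
  proof -
    define y where "y n = real n * pi / (u j - l j) * (x - l j)" for n
    have minus: "of_int (int k - int m) * pi / (u j - l j) * (x - l j) = y k - y m"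
      and plus: "of_int (int k + int m) * pi / (u j - l j) * (x - l j) = y k + y m"
      by (simp_all add: y_def algebra_simps diff_divide_distrib add_divide_distrib)
    have phi: "phi l u j n x = beta l u j n * cos (y n)" for n
      by (simp add: phi_def y_def)
    show ?thesis
      unfolding minus plus phi b_def cos_diff cos_add by (simp add: algebra_simps)
  qed
  ultimately show ?thesis by simp
qed

lemma sets_box_Rn [measurable]: "box_Rn d l u \<in> sets (lborel_Rn d)"
  unfolding box_Rn_def lborel_Rn_def by (rule sets_PiM_I_finite) auto

lemma borel_measurable_Phi [measurable]: "Phi d l u k \<in> borel_measurable (lborel_Rn d)"
  unfolding Phi_def[abs_def] phi_def lborel_Rn_def by measurable

text \<open>On the box the integrand is a product of functions of single coordinates, so Fubini
  reduces its integral to a product of one-dimensional ones.\<close>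

lemma has_bochner_integral_Phi_mult_Phi:
  assumes "\<And>j. j \<in> {1..d} \<Longrightarrow> l j < u j"
    and "k \<in> multi_indices d K" and "m \<in> multi_indices d K"
  shows "has_bochner_integral (lborel_Rn d)
    (\<lambda>x. indicator (box_Rn d l u) x * (Phi d l u k x * Phi d l u m x)) (if k = m then 1 else 0)"
proof -
  interpret product_sigma_finite "\<lambda>_::nat. lborel :: real measure" ..
  let ?g = "\<lambda>j y. phi l u j (k j) y * phi l u j (m j) y * indicator {l j..u j} y"
  have g: "has_bochner_integral lborel (?g j) (if k j = m j then 1 else 0)" if "j \<in> {1..d}" for j
    by (rule has_bochner_integral_phi_mult_phi[of l j u]) (rule assms(1)[OF that])
  have "(\<Prod>j=1..d. integral\<^sup>L lborel (?g j)) = (\<Prod>j=1..d. if k j = m j then 1 else 0)"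
    using g by (intro prod.cong refl) (rule has_bochner_integral_integral_eq)
  also have "\<dots> = (if k = m then 1 else 0)"
  proof (cases "k = m")
    case False
    \<comment> \<open>Multi-indices are extensional, so distinct ones already differ at a coordinate
      in \<open>{1..d}\<close>, which makes one factor zero.\<close>
    then obtain j where "j \<in> {1..d}" "k j \<noteq> m j"
      using assms(2,3) unfolding multi_indices_def by (metis PiE_ext)
    with False show ?thesis by (auto intro!: prod_zero)
  qed simp
  finally have "(\<Prod>j=1..d. integral\<^sup>L lborel (?g j)) = (if k = m then 1 else 0)" .
  moreover have "has_bochner_integral (PiM {1..d} (\<lambda>_. lborel)) (\<lambda>x. \<Prod>j=1..d. ?g j (x j))
      (\<Prod>j=1..d. integral\<^sup>L lborel (?g j))"
    unfolding has_bochner_integral_iff using g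
    by (intro conjI product_integrable_prod product_integral_prod)
      (auto simp: has_bochner_integral_iff)
  \<comment> \<open>The factorisation is restricted to the space of the product measure:
    \<open>box_Rn\<close> contains only extensional functions, while the product of indicators
    ignores coordinates outside \<open>{1..d}\<close>.\<close>
  moreover have "(\<Prod>j=1..d. ?g j (x j))
      = indicator (box_Rn d l u) x * (Phi d l u k x * Phi d l u m x)"
    if "x \<in> space (PiM {1..d} (\<lambda>_. lborel))" for x
  proof -
    have "(\<Prod>j=1..d. indicator {l j..u j} (x j)) = (indicator (box_Rn d l u) x :: real)"
      using that by (auto simp: box_Rn_def space_PiM indicator_def PiE_iff intro!: prod_zero)
    then show ?thesis by (simp add: prod.distrib Phi_def)
  qed
  ultimately show ?thesis
    unfolding lborel_Rn_def by (subst (asm) has_bochner_integral_cong[OF refl _ refl]) auto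
qed

text \<open>Expanding the square gives a double sum of which orthonormality keeps the diagonal. The
  conclusion also records integrability, which is needed for membership in L2.\<close>

lemma Parseval_finite:
  fixes e :: "'k \<Rightarrow> 'a \<Rightarrow> real"
  assumes "finite I"
    and "\<And>k m. k \<in> I \<Longrightarrow> m \<in> I \<Longrightarrow>
      has_bochner_integral M (\<lambda>x. indicator D x * (e k x * e m x)) (if k = m then 1 else 0)"
  shows "has_bochner_integral M (\<lambda>x. indicator D x * (\<Sum>k\<in>I. c k * e k x)\<^sup>2) (\<Sum>k\<in>I. (c k)\<^sup>2)"
proof -
  have "has_bochner_integral M
      (\<lambda>x. \<Sum>k\<in>I. \<Sum>m\<in>I. c k * c m * (indicator D x * (e k x * e m x)))
      (\<Sum>k\<in>I. \<Sum>m\<in>I. c k * c m * (if k = m then 1 else 0))"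
    by (intro has_bochner_integral_sum has_bochner_integral_mult_right assms)
  moreover have "(\<Sum>k\<in>I. \<Sum>m\<in>I. c k * c m * (if k = m then 1 else 0)) = (\<Sum>k\<in>I. (c k)\<^sup>2)"
    using assms(1) by (simp add: if_distrib power2_eq_square cong: if_cong)
  moreover have "(\<Sum>k\<in>I. \<Sum>m\<in>I. c k * c m * (indicator D x * (e k x * e m x)))
      = indicator D x * (\<Sum>k\<in>I. c k * e k x)\<^sup>2" for x
    by (simp add: power2_eq_square sum_product sum_distrib_left mult_ac)
  ultimately show ?thesis by simp
qed

text \<open>For each fixed rank tuple, a product of sums over \<open>k\<close> becomes a sum over
  multi-indices; summing over rank tuples first then collects the coefficient of each
  \<open>Phi\<close>.\<close>

lemma COS_TT_density_expansion:
  "COS_TT_density d K l u r A x = (\<Sum>k\<in>multi_indices d K. TT_tensor d r A k * Phi d l u k x)"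
proof -
  have "COS_TT_density d K l u r A x
      = (\<Sum>\<alpha>\<in>rank_indices d r. \<Sum>k\<in>multi_indices d K.
          \<Prod>j=1..d. A j (\<alpha> (j - 1)) (k j) (\<alpha> j) * phi l u j (k j) (x j))"
    unfolding COS_TT_density_def multi_indices_def
    by (intro sum.cong refl prod_sum_PiE) auto
  also have "\<dots> = (\<Sum>k\<in>multi_indices d K. TT_tensor d r A k * Phi d l u k x)"
    by (subst sum.swap) (simp add: TT_tensor_def Phi_def prod.distrib sum_distrib_right)
  finally show ?thesis .
qed

theorem theoremA1:
  fixes d :: nat
    and l u :: "nat \<Rightarrow> real"
    and f :: "(nat \<Rightarrow> real) \<Rightarrow> real"
    and K r :: "nat \<Rightarrow> nat"
    and A :: "nat \<Rightarrow> nat \<Rightarrow> nat \<Rightarrow> nat \<Rightarrow> real"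
  assumes "1 \<le> d"
    and "\<And>j. j \<in> {1..d} \<Longrightarrow> l j < u j"
    and "continuous_on (Rn d) f"
    and "\<And>x. x \<in> Rn d \<Longrightarrow> 0 \<le> f x"
    and "has_bochner_integral (lborel_Rn d) f 1"
    and "in_L2 (lborel_Rn d) (box_Rn d l u) f"
    and "\<And>j. j \<in> {1..d} \<Longrightarrow> 1 \<le> K j"
    and "r 0 = 1" and "r d = 1"
    and "\<And>j. j \<in> {1..<d} \<Longrightarrow> 1 \<le> r j"
  shows "in_L2 (lborel_Rn d) (box_Rn d l u)
           (\<lambda>x. COS_density d K l u f x - COS_TT_density d K l u r A x) \<and>
         L2_norm (lborel_Rn d) (box_Rn d l u)
           (\<lambda>x. COS_density d K l u f x - COS_TT_density d K l u r A x)
         = frobenius_norm d K (\<lambda>k. COS_tensor d l u f k - TT_tensor d r A k)"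
proof -
  define c where "c k = COS_tensor d l u f k - TT_tensor d r A k" for k
  have expansion: "COS_density d K l u f x - COS_TT_density d K l u r A x
      = (\<Sum>k\<in>multi_indices d K. c k * Phi d l u k x)" for x
    unfolding COS_density_def COS_TT_density_expansion c_def
    by (simp add: left_diff_distrib sum_subtractf)
  have "finite (multi_indices d K)"
    unfolding multi_indices_def by (intro finite_PiE) auto
  then have norm: "has_bochner_integral (lborel_Rn d)
      (\<lambda>x. indicator (box_Rn d l u) x * (\<Sum>k\<in>multi_indices d K. c k * Phi d l u k x)\<^sup>2)
      (\<Sum>k\<in>multi_indices d K. (c k)\<^sup>2)"
    by (rule Parseval_finite) (rule has_bochner_integral_Phi_mult_Phi[OF assms(2)])
  \<comment> \<open>\<open>in_L2\<close> asks for measurability of the function itself, which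
    integrability of its square does not provide.\<close>
  have "(\<lambda>x. indicator (box_Rn d l u) x * (\<Sum>k\<in>multi_indices d K. c k * Phi d l u k x))
      \<in> borel_measurable (lborel_Rn d)"
    by measurable
  with norm show ?thesis
    unfolding expansion in_L2_def L2_norm_def frobenius_norm_def set_borel_measurable_def
      set_integrable_def set_lebesgue_integral_def c_def[symmetric]
    by (simp add: has_bochner_integral_iff)
qed

end
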